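(* Let $\mathcal{L}$ be a class of structures containing the empty structure $\perp$, where each $Z\in\mathcal{L}$ has a finite ground set $V(Z)$ and each $Z\neq\perp$ has a set $R(Z)\subseteq V(Z)$ of removable elements. Suppose that for every $Z\in\mathcal{L}$ all elements of $R(Z)$ can be listed in $\Theta(p(|V(Z)|)\,q(n))$ time and the removal of an element takes $\Theta(p(|V(Z)|)\,q(n))$ time, where $p$ is a polynomial and $q(n)$ is a function of an invariant $n$ of the input structure (such as the number of edges of the original graph). If there is a constant $c$ such that $|R(Z)|\ge 2$ holds for every $Z\in\mathcal{L}$ with $|V(Z)|>c$, then all elimination orderings of a given structure of $\mathcal{L}$ can be enumerated in $O(q(n))$ (amortized) time for each.
   Context: For $Z\in\mathcal{L}$, $Z\neq\perp$, and $e\in R(Z)$, removing $e$ from $Z$ yields a uniquely determined structure $Z\setminus e\in\mathcal{L}$ with $V(Z\setminus e)=V(Z)\setminus\{e\}$; $\perp$ is the unique structure with empty ground set. An elimination ordering of $Z$ is an ordering $(z_1,\dots,z_n)$ of all elements of $V(Z)$ such that for each $i$, $z_i$ is removable in the structure $Z_i$ obtained from $Z$ by successively removing $z_1,\dots,z_{i-1}$ (so that removing all of them yields $\perp$). The time per solution is the total running time divided by the number of solutions output.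
   Formalization: The set R(Z) is assumed nonempty for every Z ≠ ⊥ (also when |V(Z)| ≤ c), i.e. every structure has an elimination ordering; otherwise the time per solution may be undefined, e.g. if R({x}) = ∅. *)

theory Defs
  imports
    Complex_Main
    "HOL-Library.Landau_Symbols"
    "HOL-Computational_Algebra.Polynomial"
begin

section \<open>Classes of structures with removable elements\<close>

record ('s, 'e) struct_class =
  structs :: "'s set"
  empty_struct :: 's
  ground :: "'s \<Rightarrow> 'e set"
  removable :: "'s \<Rightarrow> 'e set"
  del :: "'s \<Rightarrow> 'e \<Rightarrow> 's"

text \<open>The values of \<^const>\<open>removable\<close> at the empty structure, and of \<^const>\<open>del\<close> at an element
  that is not removable, are irrelevant. The nonemptiness in the fourth conjunct says that every
  structure of the class has an elimination ordering. It is automatic for structures with more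
  than \<open>c\<close> elements under the hypothesis on \<open>c\<close> in the theorem; without it, the search could run
  into small structures with no removable element, and there could be no solution to charge
  the running time to.\<close>

definition elimination_class :: "('s, 'e) struct_class \<Rightarrow> bool" where
  "elimination_class C \<longleftrightarrow>
     empty_struct C \<in> structs C \<and>
     (\<forall>Z\<in>structs C. finite (ground C Z)) \<and>
     (\<forall>Z\<in>structs C. ground C Z = {} \<longleftrightarrow> Z = empty_struct C) \<and>
     (\<forall>Z\<in>structs C. Z \<noteq> empty_struct C \<longrightarrow> removable C Z \<noteq> {} \<and> removable C Z \<subseteq> ground C Z) \<and>
     (\<forall>Z\<in>structs C. Z \<noteq> empty_struct C \<longrightarrow>
        (\<forall>e\<in>removable C Z. del C Z e \<in> structs C \<and> ground C (del C Z e) = ground C Z - {e}))"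

definition elim_ordering :: "('s, 'e) struct_class \<Rightarrow> 's \<Rightarrow> 'e list \<Rightarrow> bool" where
  "elim_ordering C Z zs \<longleftrightarrow>
     distinct zs \<and> set zs = ground C Z \<and>
     (\<forall>i<length zs. zs ! i \<in> removable C (foldl (del C) Z (take i zs)))"

inductive reachable :: "('s, 'e) struct_class \<Rightarrow> 's \<Rightarrow> 's \<Rightarrow> bool"
  for C :: "('s, 'e) struct_class" and Z\<^sub>0 :: 's where
  start: "reachable C Z\<^sub>0 Z\<^sub>0"
| step: "reachable C Z\<^sub>0 Z \<Longrightarrow> Z \<noteq> empty_struct C \<Longrightarrow> e \<in> removable C Z
    \<Longrightarrow> reachable C Z\<^sub>0 (del C Z e)"


section \<open>The two basic operations and their running times\<close>

text \<open>The first argument of each field is the original input structure, the second one the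
  structure, obtained from the input by removals, to which the operation is applied: the running
  times may depend on an invariant of the input.\<close>

record ('s, 'e) operations =
  listing :: "'s \<Rightarrow> 's \<Rightarrow> 'e list"
  list_time :: "'s \<Rightarrow> 's \<Rightarrow> nat"
  del_time :: "'s \<Rightarrow> 's \<Rightarrow> 'e \<Rightarrow> nat"

definition list_calls :: "('s, 'e) struct_class \<Rightarrow> ('s \<times> 's) set" where
  "list_calls C = {(Z\<^sub>0, Z). Z\<^sub>0 \<in> structs C \<and> reachable C Z\<^sub>0 Z \<and> Z \<noteq> empty_struct C}"

definition del_calls :: "('s, 'e) struct_class \<Rightarrow> ('s \<times> 's \<times> 'e) set" where
  "del_calls C = {(Z\<^sub>0, Z, e). (Z\<^sub>0, Z) \<in> list_calls C \<and> e \<in> removable C Z}"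

text \<open>Running times are numbers of steps, and every operation takes at least one step.\<close>

definition implements :: "('s, 'e) operations \<Rightarrow> ('s, 'e) struct_class \<Rightarrow> bool" where
  "implements Op C \<longleftrightarrow>
     (\<forall>(Z\<^sub>0, Z)\<in>list_calls C.
        distinct (listing Op Z\<^sub>0 Z) \<and> set (listing Op Z\<^sub>0 Z) = removable C Z \<and>
        1 \<le> list_time Op Z\<^sub>0 Z) \<and>
     (\<forall>(Z\<^sub>0, Z, e)\<in>del_calls C. 1 \<le> del_time Op Z\<^sub>0 Z e)"


section \<open>Enumeration algorithms\<close>

text \<open>Algorithms are programs of a unit-cost random access machine with indirect addressing,
  which has one memory for natural numbers, one for (references to) structures, and one for
  elements. Structures and elements are opaque: apart from testing a structure for emptiness,
  a program learns about them only through the two operations, which are charged their running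
  times; all other instructions take one step. (Expressions need not be charged separately:
  a program contains finitely many of them, each of constant size.)

  Solutions are output by difference: the machine holds one current sequence, modified at its
  end by \<open>Push\<close> and \<open>Pop\<close>, and \<open>Emit\<close> declares the current sequence to be the next solution.
  Otherwise writing down a solution would alone take time linear in its length.\<close>

datatype aexp = Num nat | Mem aexp | Plus aexp aexp | Minus aexp aexp

datatype test = Less aexp aexp | IsEmpty aexp

datatype prog =
    Store aexp aexp
  | ListR aexp aexp aexp   \<comment> \<open>structure address, address of the first element, address for the count\<close>
  | Delete aexp aexp aexp  \<comment> \<open>structure address, element address, address for the result\<close>
  | Push aexp
  | Pop
  | Emit
  | Seq prog prog
  | If test prog prog
  | While test prog

record ('s, 'e) state =
  mem :: "nat \<Rightarrow> nat"
  str :: "nat \<Rightarrow> 's"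
  elt :: "nat \<Rightarrow> 'e"
  cur :: "'e list"
  out :: "'e list list"

fun aval :: "aexp \<Rightarrow> (nat \<Rightarrow> nat) \<Rightarrow> nat" where
  "aval (Num k) m = k"
| "aval (Mem a) m = m (aval a m)"
| "aval (Plus a b) m = aval a m + aval b m"
| "aval (Minus a b) m = aval a m - aval b m"

fun holds :: "('s, 'e) struct_class \<Rightarrow> test \<Rightarrow> ('s, 'e) state \<Rightarrow> bool" where
  "holds C (Less a b) s \<longleftrightarrow> aval a (mem s) < aval b (mem s)"
| "holds C (IsEmpty a) s \<longleftrightarrow> str s (aval a (mem s)) = empty_struct C"

definition write_list :: "nat \<Rightarrow> 'e list \<Rightarrow> (nat \<Rightarrow> 'e) \<Rightarrow> nat \<Rightarrow> 'e" where
  "write_list b xs f = (\<lambda>i. if b \<le> i \<and> i < b + length xs then xs ! (i - b) else f i)"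

text \<open>\<open>exec C Op Z\<^sub>0 P s t s'\<close>: on input \<open>Z\<^sub>0\<close>, the program \<open>P\<close> started in state \<open>s\<close> halts in
  state \<open>s'\<close> after \<open>t\<close> steps. Illegal calls of the operations have no execution.\<close>

inductive exec ::
  "('s, 'e) struct_class \<Rightarrow> ('s, 'e) operations \<Rightarrow> 's \<Rightarrow> prog \<Rightarrow>
     ('s, 'e) state \<Rightarrow> nat \<Rightarrow> ('s, 'e) state \<Rightarrow> bool"
  for C :: "('s, 'e) struct_class" and Op :: "('s, 'e) operations" and Z\<^sub>0 :: 's where
  Store: "exec C Op Z\<^sub>0 (Store a b) s 1
            (s\<lparr>mem := (mem s)(aval a (mem s) := aval b (mem s))\<rparr>)"
| ListR: "Z = str s (aval a (mem s)) \<Longrightarrow> Z \<noteq> empty_struct C \<Longrightarrow> xs = listing Op Z\<^sub>0 Z \<Longrightarrow>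
          exec C Op Z\<^sub>0 (ListR a b d) s (list_time Op Z\<^sub>0 Z)
            (s\<lparr>elt := write_list (aval b (mem s)) xs (elt s),
               mem := (mem s)(aval d (mem s) := length xs)\<rparr>)"
| Delete: "Z = str s (aval a (mem s)) \<Longrightarrow> Z \<noteq> empty_struct C \<Longrightarrow>
          e = elt s (aval b (mem s)) \<Longrightarrow> e \<in> removable C Z \<Longrightarrow>
          exec C Op Z\<^sub>0 (Delete a b d) s (del_time Op Z\<^sub>0 Z e)
            (s\<lparr>str := (str s)(aval d (mem s) := del C Z e)\<rparr>)"
| Push: "exec C Op Z\<^sub>0 (Push a) s 1 (s\<lparr>cur := cur s @ [elt s (aval a (mem s))]\<rparr>)"
| Pop: "exec C Op Z\<^sub>0 Pop s 1 (s\<lparr>cur := butlast (cur s)\<rparr>)"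
| Emit: "exec C Op Z\<^sub>0 Emit s 1 (s\<lparr>out := out s @ [cur s]\<rparr>)"
| Seq: "exec C Op Z\<^sub>0 P s t s' \<Longrightarrow> exec C Op Z\<^sub>0 Q s' u s'' \<Longrightarrow>
          exec C Op Z\<^sub>0 (Seq P Q) s (t + u) s''"
| IfTrue: "holds C b s \<Longrightarrow> exec C Op Z\<^sub>0 P s t s' \<Longrightarrow> exec C Op Z\<^sub>0 (If b P Q) s (1 + t) s'"
| IfFalse: "\<not> holds C b s \<Longrightarrow> exec C Op Z\<^sub>0 Q s t s' \<Longrightarrow> exec C Op Z\<^sub>0 (If b P Q) s (1 + t) s'"
| WhileTrue: "holds C b s \<Longrightarrow> exec C Op Z\<^sub>0 P s t s' \<Longrightarrow> exec C Op Z\<^sub>0 (While b P) s' u s'' \<Longrightarrow>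
          exec C Op Z\<^sub>0 (While b P) s (1 + t + u) s''"
| WhileFalse: "\<not> holds C b s \<Longrightarrow> exec C Op Z\<^sub>0 (While b P) s 1 s"

definition init_state :: "'s \<Rightarrow> ('s, 'e) state" where
  "init_state Z = \<lparr>mem = (\<lambda>_. 0), str = (\<lambda>_. Z), elt = (\<lambda>_. undefined), cur = [], out = []\<rparr>"

definition enumerates_in ::
  "('s, 'e) struct_class \<Rightarrow> ('s, 'e) operations \<Rightarrow> prog \<Rightarrow> 's \<Rightarrow> nat \<Rightarrow> bool" where
  "enumerates_in C Op P Z t \<longleftrightarrow>
     (\<exists>s. exec C Op Z P (init_state Z) t s \<and>
          distinct (out s) \<and> set (out s) = {zs. elim_ordering C Z zs})"

end

theory Submission
  imports Defs
begin

text \<open>Backtracking over the partial elimination orderings works. At a structure with \<open>k\<close> elements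
  and \<open>m\<close> removable elements it spends \<open>O(m |p(k)| q(n))\<close> time outside of its recursive calls, and the
  subtree below contains at least \<open>m 2^(k - 1 - c)\<close> solutions, because the search branches at least
  twice above level \<open>c\<close> and never runs into a dead end. Charging the time to these solutions, each
  solution receives \<open>O(|p(k)| 2^(-k) q(n))\<close> from its ancestor of size \<open>k\<close>, and the sum of
  \<open>|p(k)| 2^(-k)\<close> over all \<open>k\<close> converges. The constant time spent on a solution itself is charged
  to the deletion that leads to it, which takes at least one step; only the empty input has no
  such deletion.\<close>

section \<open>Elimination orderings\<close>

lemma elim_ordering_Nil: "elim_ordering C Z [] \<longleftrightarrow> ground C Z = {}"
  by (auto simp: elim_ordering_def)

text \<open>Deleting \<open>e\<close> first shifts every prefix by one position, and
  \<open>e\<close> is missing from the ground set of \<open>del C Z e\<close>, which accounts for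
  distinctness.\<close>

lemma elim_ordering_Cons:
  assumes "elimination_class C" "Z \<in> structs C" "Z \<noteq> empty_struct C"
  shows "elim_ordering C Z (e # zs) \<longleftrightarrow> e \<in> removable C Z \<and> elim_ordering C (del C Z e) zs"
proof (cases "e \<in> removable C Z")
  case True
  then have "ground C (del C Z e) = ground C Z - {e}" "e \<in> ground C Z"
    using assms unfolding elimination_class_def by blast+
  then show ?thesis
    using True by (auto simp: elim_ordering_def All_less_Suc2)
next
  case False
  then show ?thesis
    by (auto simp: elim_ordering_def All_less_Suc2)
qed

text \<open>The recursion runs on the size, as structures are opaque. The \<open>rev\<close> makes
  this list agree with the output order of the program, which takes the last listed element
  first.\<close>

primrec orderings ::
  "('s, 'e) struct_class \<Rightarrow> ('s, 'e) operations \<Rightarrow> 's \<Rightarrow> nat \<Rightarrow> 's \<Rightarrow> 'e list list" where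
  "orderings C Op Z\<^sub>0 0 Z = [[]]"
| "orderings C Op Z\<^sub>0 (Suc k) Z =
     concat (map (\<lambda>e. map ((#) e) (orderings C Op Z\<^sub>0 k (del C Z e))) (rev (listing Op Z\<^sub>0 Z)))"

section \<open>Structures reachable from the input, graded by size\<close>

locale enumeration =
  fixes C :: "('s, 'e) struct_class" and Op :: "('s, 'e) operations" and Z\<^sub>0 :: 's
  assumes elimination_class: "elimination_class C"
    and implements: "implements Op C"
    and input: "Z\<^sub>0 \<in> structs C"
begin

text \<open>Reachability is included because the operations are specified only on structures
  obtained from the input.\<close>

definition level :: "nat \<Rightarrow> 's set" where
  "level k = {Z \<in> structs C. reachable C Z\<^sub>0 Z \<and> card (ground C Z) = k}"

lemma level_0: "Z \<in> level 0 \<Longrightarrow> Z = empty_struct C"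
  using elimination_class by (auto simp: level_def elimination_class_def)

lemma level_input: "Z\<^sub>0 \<in> level (card (ground C Z\<^sub>0))"
  using input by (simp add: level_def reachable.start)

context
  fixes Z k assumes Z: "Z \<in> level (Suc k)"
begin

lemma level_Suc_nonempty: "Z \<noteq> empty_struct C"
  using Z elimination_class by (auto simp: level_def elimination_class_def)

lemma level_Suc_list_calls: "(Z\<^sub>0, Z) \<in> list_calls C"
  using Z level_Suc_nonempty input by (simp add: level_def list_calls_def)

lemma level_Suc_listing:
  "distinct (listing Op Z\<^sub>0 Z)" "set (listing Op Z\<^sub>0 Z) = removable C Z"
  using implements level_Suc_list_calls unfolding implements_def by blast+

lemma level_Suc_removable: "removable C Z \<noteq> {}"
  using Z elimination_class level_Suc_nonempty by (auto simp: level_def elimination_class_def)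

lemma level_Suc_del:
  assumes e: "e \<in> removable C Z"
  shows "del C Z e \<in> level k"
proof -
  have ZZ: "Z \<in> structs C" "reachable C Z\<^sub>0 Z" "card (ground C Z) = Suc k"
    using Z by (auto simp: level_def)
  have "e \<in> ground C Z" "finite (ground C Z)"
    "del C Z e \<in> structs C" "ground C (del C Z e) = ground C Z - {e}"
    using elimination_class ZZ level_Suc_nonempty e unfolding elimination_class_def by blast+
  then show ?thesis
    using ZZ e level_Suc_nonempty by (auto simp: level_def intro: reachable.step)
qed

end

lemma orderings_correct:
  "Z \<in> level k \<Longrightarrow> distinct (orderings C Op Z\<^sub>0 k Z) \<and>
     set (orderings C Op Z\<^sub>0 k Z) = {zs. elim_ordering C Z zs}"
proof (induction k arbitrary: Z)
  case 0
  then have "ground C Z = {}"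
    using elimination_class level_0 by (auto simp: level_def elimination_class_def)
  then show ?case
    by (auto simp: elim_ordering_def)
next
  case (Suc k)
  note Z = Suc.prems
  have IH: "distinct (orderings C Op Z\<^sub>0 k (del C Z e))"
    "set (orderings C Op Z\<^sub>0 k (del C Z e)) = {zs. elim_ordering C (del C Z e) zs}"
    if "e \<in> removable C Z" for e
    using Suc.IH level_Suc_del[OF Z that] by auto
  have Cons: "elim_ordering C Z (e # zs) \<longleftrightarrow>
      e \<in> removable C Z \<and> elim_ordering C (del C Z e) zs" for e zs
    using elim_ordering_Cons[OF elimination_class _ level_Suc_nonempty[OF Z]] Z
    by (simp add: level_def)
  have "\<not> elim_ordering C Z []"
    using elimination_class level_Suc_nonempty[OF Z] Z
    by (auto simp: elim_ordering_Nil level_def)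
  then have "zs \<in> set (orderings C Op Z\<^sub>0 (Suc k) Z) \<longleftrightarrow> elim_ordering C Z zs" for zs
    using level_Suc_listing[OF Z] IH(2) by (cases zs) (auto simp: Cons)
  moreover have "distinct (concat (map (\<lambda>e. map ((#) e) (orderings C Op Z\<^sub>0 k (del C Z e))) xs))"
    if "distinct xs" "set xs \<subseteq> removable C Z" for xs
    using that by (induction xs) (auto simp: IH(1) distinct_map)
  then have "distinct (orderings C Op Z\<^sub>0 (Suc k) Z)"
    using level_Suc_listing[OF Z] by simp
  ultimately show ?case
    by blast
qed

section \<open>Exponential growth of the number of orderings\<close>

lemma length_orderings_Suc:
  assumes Z: "Z \<in> level (Suc k)"
  shows "length (orderings C Op Z\<^sub>0 (Suc k) Z) =
    (\<Sum>e\<in>removable C Z. length (orderings C Op Z\<^sub>0 k (del C Z e)))"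
  using level_Suc_listing[OF Z]
  by (simp add: length_concat rev_map[symmetric] comp_def sum_list_distinct_conv_sum_set)

text \<open>Each size above \<open>c\<close> contributes a factor of at least 2, each smaller
  positive size at least 1, since there are no dead ends. Truncated subtraction makes the bound 1
  for \<open>k\<close> up to \<open>c\<close>.\<close>

lemma length_orderings_ge:
  assumes branching: "\<And>Z. Z \<in> structs C \<Longrightarrow> c < card (ground C Z) \<Longrightarrow> 2 \<le> card (removable C Z)"
  shows "Z \<in> level k \<Longrightarrow> 2 ^ (k - c) \<le> length (orderings C Op Z\<^sub>0 k Z)"
proof (induction k arbitrary: Z)
  case 0
  then show ?case by simp
next
  case (Suc k)
  note Z = Suc.prems
  have fin: "finite (removable C Z)"
    using level_Suc_listing(2)[OF Z] by (metis finite_set)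
  have "card (removable C Z) \<ge> 1"
    using fin level_Suc_removable[OF Z] by (simp add: Suc_leI card_gt_0_iff)
  moreover have "card (removable C Z) \<ge> 2" if "c < Suc k"
    using branching[of Z] that Z by (simp add: level_def)
  ultimately have "2 ^ (Suc k - c) \<le> card (removable C Z) * 2 ^ (k - c)"
    by (cases "c < Suc k") (auto simp: Suc_diff_le)
  also have "\<dots> \<le> (\<Sum>e\<in>removable C Z. length (orderings C Op Z\<^sub>0 k (del C Z e)))"
    using sum_bounded_below[of "removable C Z" "2 ^ (k - c) :: nat"] Suc.IH level_Suc_del[OF Z]
    by simp
  finally show ?case
    using length_orderings_Suc[OF Z] by simp
qed

end


section \<open>The program\<close>

text \<open>The elements that remain to be removed at the structures on the current path form one stack
  in the element memory. Cell 0 is its stack pointer, cell 1 the depth \<open>d\<close> of the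
  search (the input has depth 1), and cell \<open>d + 2\<close> holds the number of remaining elements at
  depth \<open>d\<close>, whose structure is in cell \<open>d\<close> of the structure memory. Solutions are frames
  without elements. The \<open>Pop\<close> on leaving the input acts on the empty sequence.\<close>

abbreviation "pointer \<equiv> Mem (Num 0)"
abbreviation "depth \<equiv> Mem (Num 1)"
abbreviation "count_address \<equiv> Plus depth (Num 2)"

definition enter :: prog where
  "enter = If (IsEmpty depth)
     (Seq Emit (Store count_address (Num 0)))
     (Seq (ListR depth pointer count_address)
          (Store (Num 0) (Plus pointer (Mem count_address))))"

text \<open>The pointer is lowered first, so that \<open>Push\<close> and \<open>Delete\<close> both
  address the top element. The child goes into the next structure cell, which keeps the parent for
  the remaining siblings.\<close>

definition search_step :: prog where
  "search_step = If (Less (Num 0) (Mem count_address))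
     (Seq (Store count_address (Minus (Mem count_address) (Num 1)))
     (Seq (Store (Num 0) (Minus pointer (Num 1)))
     (Seq (Push pointer)
     (Seq (Delete depth pointer (Plus depth (Num 1)))
     (Seq (Store (Num 1) (Plus depth (Num 1)))
          enter)))))
     (Seq (Store (Num 1) (Minus depth (Num 1))) Pop)"

definition search :: prog where
  "search = While (Less (Num 0) depth) search_step"

definition enumerate :: prog where
  "enumerate = Seq (Store (Num 1) (Num 1)) (Seq enter search)"

text \<open>A leaf takes 3 steps to enter and 4 to leave. Otherwise entering takes 2 steps besides
  the listing, leaving takes 4, and each descent takes 6 besides the deletion.\<close>

primrec search_time ::
  "('s, 'e) struct_class \<Rightarrow> ('s, 'e) operations \<Rightarrow> 's \<Rightarrow> nat \<Rightarrow> 's \<Rightarrow> nat" where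
  "search_time C Op Z\<^sub>0 0 Z = 7"
| "search_time C Op Z\<^sub>0 (Suc k) Z = list_time Op Z\<^sub>0 Z + 6 +
     (\<Sum>e\<leftarrow>listing Op Z\<^sub>0 Z. 6 + del_time Op Z\<^sub>0 Z e + search_time C Op Z\<^sub>0 k (del C Z e))"

text \<open>Big-step semantics has no intermediate states of a loop, so a partial run is described
  by how it prolongs every completion of the loop.\<close>

definition (in enumeration) leads ::
  "('s, 'e) state \<Rightarrow> nat \<Rightarrow> ('s, 'e) state \<Rightarrow> bool" where
  "leads s t s' \<longleftrightarrow>
     (\<forall>u s''. exec C Op Z\<^sub>0 search s' u s'' \<longrightarrow> exec C Op Z\<^sub>0 search s (t + u) s'')"

text \<open>Frame condition for leaving a subtree at depth \<open>d + 1\<close> with stack base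
  \<open>b\<close>: the cells used by its ancestors are intact, and \<open>butlast\<close> undoes
  the \<open>Push\<close> that led into it, if any.\<close>

definition returned :: "nat \<Rightarrow> nat \<Rightarrow> ('s, 'e) state \<Rightarrow> ('s, 'e) state \<Rightarrow> bool" where
  "returned d b s s' \<longleftrightarrow> mem s' 0 = b \<and> mem s' 1 = d \<and> cur s' = butlast (cur s) \<and>
     (\<forall>i\<le>d. mem s' (i + 2) = mem s (i + 2) \<and> str s' i = str s i) \<and> (\<forall>i<b. elt s' i = elt s i)"

section \<open>Execution of single loop iterations\<close>

context enumeration
begin

lemma leads_trans: "leads s t s' \<Longrightarrow> leads s' u s'' \<Longrightarrow> leads s (t + u) s''"
  by (simp add: leads_def add.assoc)

lemma leads_step:
  assumes "0 < mem s 1" "exec C Op Z\<^sub>0 search_step s t s'"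
  shows "leads s (1 + t) s'"
  unfolding leads_def search_def using assms by (intro allI impI exec.WhileTrue) auto

lemma leads_exit:
  assumes "mem s 1 = Suc d" "mem s (d + 3) = 0"
  shows "leads s 4 (s\<lparr>mem := (mem s)(1 := d), cur := butlast (cur s)\<rparr>)"
proof -
  let ?s1 = "s\<lparr>mem := (mem s)(1 := d)\<rparr>"
  have "exec C Op Z\<^sub>0 (Store (Num 1) (Minus depth (Num 1))) s 1 ?s1"
    using exec.Store[of C Op Z\<^sub>0 "Num 1" "Minus depth (Num 1)" s] assms by simp
  moreover have "exec C Op Z\<^sub>0 Pop ?s1 1 (s\<lparr>mem := (mem s)(1 := d), cur := butlast (cur s)\<rparr>)"
    using exec.Pop[of C Op Z\<^sub>0 ?s1] by simp
  ultimately have "exec C Op Z\<^sub>0 search_step s (1 + (1 + 1))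
      (s\<lparr>mem := (mem s)(1 := d), cur := butlast (cur s)\<rparr>)"
    unfolding search_step_def using assms
    by (intro exec.IfFalse exec.Seq) (auto simp: numeral_3_eq_3)
  from leads_step[OF _ this] show ?thesis
    using assms(1) by (simp add: numeral_eq_Suc)
qed

definition next_state :: "nat \<Rightarrow> ('s, 'e) state \<Rightarrow> ('s, 'e) state" where
  "next_state d s = (let b = mem s 0 - 1 in
     s\<lparr>cur := cur s @ [elt s b],
       str := (str s)(d + 2 := del C (str s (d + 1)) (elt s b)),
       mem := (mem s)(d + 3 := mem s (d + 3) - 1, 0 := b, 1 := d + 2)\<rparr>)"

text \<open>The child is opened in the same iteration that deletes the element, hence the summand
  \<open>t\<close>.\<close>

lemma leads_next:
  assumes "mem s 1 = Suc d" "0 < mem s (d + 3)"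
    and "str s (Suc d) \<noteq> empty_struct C"
    and "elt s (mem s 0 - 1) \<in> removable C (str s (Suc d))"
    and "exec C Op Z\<^sub>0 enter (next_state d s) t s'"
  shows "leads s (6 + del_time Op Z\<^sub>0 (str s (Suc d)) (elt s (mem s 0 - 1)) + t) s'"
proof -
  define s1 where "s1 = s\<lparr>mem := (mem s)(d + 3 := mem s (d + 3) - 1)\<rparr>"
  define s2 where "s2 = s1\<lparr>mem := (mem s1)(0 := mem s 0 - 1)\<rparr>"
  define s3 where "s3 = s2\<lparr>cur := cur s @ [elt s (mem s 0 - 1)]\<rparr>"
  define s4 where
    "s4 = s3\<lparr>str := (str s)(d + 2 := del C (str s (d + 1)) (elt s (mem s 0 - 1)))\<rparr>"
  note defs = s1_def s2_def s3_def s4_def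
  have 1: "exec C Op Z\<^sub>0 (Store count_address (Minus (Mem count_address) (Num 1))) s 1 s1"
    using exec.Store[of C Op Z\<^sub>0 count_address "Minus (Mem count_address) (Num 1)" s] assms(1)
    by (simp add: defs numeral_3_eq_3)
  have 2: "exec C Op Z\<^sub>0 (Store (Num 0) (Minus pointer (Num 1))) s1 1 s2"
    using exec.Store[of C Op Z\<^sub>0 "Num 0" "Minus pointer (Num 1)" s1]
    by (simp add: defs)
  have 3: "exec C Op Z\<^sub>0 (Push pointer) s2 1 s3"
    using exec.Push[of C Op Z\<^sub>0 pointer s2] by (simp add: defs)
  have 4: "exec C Op Z\<^sub>0 (Delete depth pointer (Plus depth (Num 1))) s3
      (del_time Op Z\<^sub>0 (str s (Suc d)) (elt s (mem s 0 - 1))) s4"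
    using exec.Delete[of "str s (Suc d)" s3 depth C "elt s (mem s 0 - 1)" pointer Op Z\<^sub>0
        "Plus depth (Num 1)"] assms
    by (simp add: defs)
  have 5: "exec C Op Z\<^sub>0 (Store (Num 1) (Plus depth (Num 1))) s4 1 (next_state d s)"
    using exec.Store[of C Op Z\<^sub>0 "Num 1" "Plus depth (Num 1)" s4] assms(1)
    by (simp add: defs next_state_def Let_def)
  have "exec C Op Z\<^sub>0 search_step s
      (1 + (1 + (1 + (1 + (del_time Op Z\<^sub>0 (str s (Suc d)) (elt s (mem s 0 - 1)) + (1 + t)))))) s'"
    unfolding search_step_def
    by (intro exec.IfTrue exec.Seq[OF 1] exec.Seq[OF 2] exec.Seq[OF 3] exec.Seq[OF 4]
        exec.Seq[OF 5] assms(5)) (use assms in \<open>auto simp: numeral_3_eq_3\<close>)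
  from leads_step[OF _ this] show ?thesis
    using assms(1) by (simp add: numeral_eq_Suc add_ac)
qed

lemma enter_empty:
  assumes "mem s 1 = Suc d" "str s (Suc d) = empty_struct C"
  shows "exec C Op Z\<^sub>0 enter s 3 (s\<lparr>out := out s @ [cur s], mem := (mem s)(d + 3 := 0)\<rparr>)"
proof -
  let ?s1 = "s\<lparr>out := out s @ [cur s]\<rparr>"
  have "exec C Op Z\<^sub>0 (Store count_address (Num 0)) ?s1 1
      (s\<lparr>out := out s @ [cur s], mem := (mem s)(d + 3 := 0)\<rparr>)"
    using exec.Store[of C Op Z\<^sub>0 count_address "Num 0" ?s1] assms(1)
    by (simp add: numeral_3_eq_3)
  then have "exec C Op Z\<^sub>0 enter s (1 + (1 + 1))
      (s\<lparr>out := out s @ [cur s], mem := (mem s)(d + 3 := 0)\<rparr>)"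
    unfolding enter_def using assms
    by (intro exec.IfTrue exec.Seq[OF exec.Emit]) auto
  then show ?thesis
    by (simp add: numeral_3_eq_3)
qed

lemma enter_nonempty:
  assumes "mem s 1 = Suc d" "str s (Suc d) \<noteq> empty_struct C"
  defines "xs \<equiv> listing Op Z\<^sub>0 (str s (Suc d))"
  shows "exec C Op Z\<^sub>0 enter s (list_time Op Z\<^sub>0 (str s (Suc d)) + 2)
    (s\<lparr>elt := write_list (mem s 0) xs (elt s),
       mem := (mem s)(d + 3 := length xs, 0 := mem s 0 + length xs)\<rparr>)"
proof -
  let ?s1 = "s\<lparr>elt := write_list (mem s 0) xs (elt s), mem := (mem s)(d + 3 := length xs)\<rparr>"
  have 1: "exec C Op Z\<^sub>0 (ListR depth pointer count_address) s
      (list_time Op Z\<^sub>0 (str s (Suc d))) ?s1"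
    using exec.ListR[of "str s (Suc d)" s depth C xs Op Z\<^sub>0 pointer count_address] assms
    by (simp add: numeral_3_eq_3)
  have "exec C Op Z\<^sub>0 (Store (Num 0) (Plus pointer (Mem count_address))) ?s1 1
      (s\<lparr>elt := write_list (mem s 0) xs (elt s),
         mem := (mem s)(d + 3 := length xs, 0 := mem s 0 + length xs)\<rparr>)"
    using exec.Store[of C Op Z\<^sub>0 "Num 0" "Plus pointer (Mem count_address)" ?s1] assms(1)
    by (simp add: numeral_3_eq_3)
  from exec.Seq[OF 1 this] have "exec C Op Z\<^sub>0 enter s (1 + (list_time Op Z\<^sub>0 (str s (Suc d)) + 1))
      (s\<lparr>elt := write_list (mem s 0) xs (elt s),
         mem := (mem s)(d + 3 := length xs, 0 := mem s 0 + length xs)\<rparr>)"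
    unfolding enter_def using assms by (intro exec.IfFalse) auto
  then show ?thesis
    by simp
qed

section \<open>Correctness of the search of a subtree\<close>

text \<open>The run is split because \<open>enter\<close> is executed inside an iteration already
  begun, or before the loop for the input, whereas the rest consists of whole iterations.\<close>

definition visits :: "nat \<Rightarrow> 's \<Rightarrow> bool" where
  "visits k Z \<longleftrightarrow> (\<forall>s d. mem s 1 = Suc d \<longrightarrow> str s (Suc d) = Z \<longrightarrow>
     (\<exists>t s1 u s2. exec C Op Z\<^sub>0 enter s t s1 \<and> leads s1 u s2 \<and>
        t + u = search_time C Op Z\<^sub>0 k Z \<and> returned d (mem s 0) s s2 \<and>
        out s2 = out s @ map ((@) (cur s)) (orderings C Op Z\<^sub>0 k Z)))"

text \<open>The elements are taken from the top of the stack, that is, from the end of the list.\<close>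

lemma search_siblings:
  assumes Z: "Z \<noteq> empty_struct C"
    and visits: "\<And>e. e \<in> removable C Z \<Longrightarrow> visits k (del C Z e)"
  shows "mem s 1 = Suc d \<Longrightarrow> str s (Suc d) = Z \<Longrightarrow> mem s (d + 3) = length xs \<Longrightarrow>
    mem s 0 = b + length xs \<Longrightarrow> (\<And>i. i < length xs \<Longrightarrow> elt s (b + i) = xs ! i) \<Longrightarrow>
    set xs \<subseteq> removable C Z \<Longrightarrow>
    \<exists>s'. leads s (4 + (\<Sum>e\<leftarrow>xs. 6 + del_time Op Z\<^sub>0 Z e + search_time C Op Z\<^sub>0 k (del C Z e))) s' \<and>
      returned d b s s' \<and>
      out s' = out s @ map ((@) (cur s))
        (concat (map (\<lambda>e. map ((#) e) (orderings C Op Z\<^sub>0 k (del C Z e))) (rev xs)))"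
proof (induction xs arbitrary: s rule: rev_induct)
  case Nil
  then show ?case
    using leads_exit[of s d]
    by (intro exI[of _ "s\<lparr>mem := (mem s)(1 := d), cur := butlast (cur s)\<rparr>"])
       (auto simp: returned_def)
next
  case (snoc x xs)
  let ?s = "next_state d s"
  have x: "elt s (mem s 0 - 1) = x" "x \<in> removable C Z"
    using snoc.prems(4-6) snoc.prems(5)[of "length xs"] by auto
  have s: "mem ?s 1 = Suc (Suc d)" "str ?s (Suc (Suc d)) = del C Z x"
    "mem ?s 0 = b + length xs" "cur ?s = cur s @ [x]" "out ?s = out s" "elt ?s = elt s"
    "mem ?s (d + 3) = length xs" "str ?s (Suc d) = Z"
    "\<And>i. i \<le> d \<Longrightarrow> mem ?s (i + 2) = mem s (i + 2) \<and> str ?s i = str s i"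
    using snoc.prems x by (auto simp: next_state_def Let_def)
  obtain t s1 u s2 where s1: "exec C Op Z\<^sub>0 enter ?s t s1" and s2: "leads s1 u s2"
    and tu: "t + u = search_time C Op Z\<^sub>0 k (del C Z x)"
    and ret: "returned (Suc d) (b + length xs) ?s s2"
    and out: "out s2 = out s @ map ((@) (cur s @ [x])) (orderings C Op Z\<^sub>0 k (del C Z x))"
    using visits[OF x(2)] s unfolding visits_def by metis
  have "leads s (6 + del_time Op Z\<^sub>0 Z x + t) s1"
    using leads_next[of s d t s1] snoc.prems x Z s1 by simp
  then have *: "leads s (6 + del_time Op Z\<^sub>0 Z x + search_time C Op Z\<^sub>0 k (del C Z x)) s2"
    using leads_trans[OF _ s2] tu by (metis add.assoc)
  have "mem s2 1 = Suc d" "mem s2 0 = b + length xs" "cur s2 = cur s"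
    using ret s by (auto simp: returned_def)
  \<comment> \<open>The child's frame reaches up to depth \<open>Suc d\<close>, so the parent's
    structure and remaining count survive. The stack survives below the cell of \<open>x\<close>,
    where the siblings still to be visited lie.\<close>
  moreover have frame: "mem s2 (i + 2) = mem ?s (i + 2)" "str s2 i = str ?s i" if "i \<le> Suc d" for i
    using ret that by (auto simp: returned_def)
  have "str s2 (Suc d) = Z" "mem s2 (d + 3) = length xs"
    using frame[of "Suc d"] s by (simp_all add: numeral_3_eq_3)
  moreover have elt: "elt s2 i = elt s i" if "i < b + length xs" for i
    using ret s that by (auto simp: returned_def)
  have "elt s2 (b + i) = xs ! i" if "i < length xs" for i
    using elt[of "b + i"] snoc.prems(5)[of i] that by (simp add: nth_append)
  moreover have "set xs \<subseteq> removable C Z"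
    using snoc.prems by simp
  ultimately obtain s' where s': "leads s2
      (4 + (\<Sum>e\<leftarrow>xs. 6 + del_time Op Z\<^sub>0 Z e + search_time C Op Z\<^sub>0 k (del C Z e))) s'"
    and ret': "returned d b s2 s'"
    and out': "out s' = out s2 @ map ((@) (cur s))
        (concat (map (\<lambda>e. map ((#) e) (orderings C Op Z\<^sub>0 k (del C Z e))) (rev xs)))"
    using snoc.IH[of s2] by auto
  have "returned d b s s'"
    using ret' \<open>cur s2 = cur s\<close> frame s(9) elt by (auto simp: returned_def)
  moreover have "out s' = out s @ map ((@) (cur s))
      (concat (map (\<lambda>e. map ((#) e) (orderings C Op Z\<^sub>0 k (del C Z e))) (rev (xs @ [x]))))"
    by (simp add: out' out comp_def)
  ultimately show ?case
    using leads_trans[OF * s'] by (intro exI[of _ s']) (simp add: add_ac)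
qed

lemma visits_level: "Z \<in> level k \<Longrightarrow> visits k Z"
proof (induction k arbitrary: Z)
  case 0
  show ?case
    unfolding visits_def
  proof (intro allI impI)
    fix s :: "('s, 'e) state" and d
    assume s: "mem s 1 = Suc d" "str s (Suc d) = Z"
    let ?s1 = "s\<lparr>out := out s @ [cur s], mem := (mem s)(d + 3 := 0)\<rparr>"
    let ?s2 = "?s1\<lparr>mem := (mem ?s1)(1 := d), cur := butlast (cur ?s1)\<rparr>"
    have "exec C Op Z\<^sub>0 enter s 3 ?s1"
      using enter_empty[OF s(1)] s(2) level_0[OF 0] by simp
    moreover have "leads ?s1 4 ?s2"
      by (rule leads_exit) (use s in simp_all)
    moreover have "returned d (mem s 0) s ?s2"
      by (auto simp: returned_def)
    ultimately show "\<exists>t s1 u s2. exec C Op Z\<^sub>0 enter s t s1 \<and> leads s1 u s2 \<and>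
        t + u = search_time C Op Z\<^sub>0 0 Z \<and> returned d (mem s 0) s s2 \<and>
        out s2 = out s @ map ((@) (cur s)) (orderings C Op Z\<^sub>0 0 Z)"
      by (intro exI[of _ 3] exI[of _ 4] exI[of _ ?s1] exI[of _ ?s2]) auto
  qed
next
  case (Suc k)
  note Z = Suc.prems
  define xs where "xs = listing Op Z\<^sub>0 Z"
  show ?case
    unfolding visits_def
  proof (intro allI impI)
    fix s :: "('s, 'e) state" and d
    assume s: "mem s 1 = Suc d" "str s (Suc d) = Z"
    let ?s1 = "s\<lparr>elt := write_list (mem s 0) xs (elt s),
        mem := (mem s)(d + 3 := length xs, 0 := mem s 0 + length xs)\<rparr>"
    let ?u = "4 + (\<Sum>e\<leftarrow>xs. 6 + del_time Op Z\<^sub>0 Z e + search_time C Op Z\<^sub>0 k (del C Z e))"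
    have enter: "exec C Op Z\<^sub>0 enter s (list_time Op Z\<^sub>0 Z + 2) ?s1"
      using enter_nonempty[OF s(1)] s(2) level_Suc_nonempty[OF Z] by (simp add: xs_def)
    have "visits k (del C Z e)" if "e \<in> removable C Z" for e
      using Suc.IH level_Suc_del[OF Z that] by blast
    then obtain s2 where s2: "leads ?s1 ?u s2" "returned d (mem s 0) ?s1 s2"
      "out s2 = out s @ map ((@) (cur s))
        (concat (map (\<lambda>e. map ((#) e) (orderings C Op Z\<^sub>0 k (del C Z e))) (rev xs)))"
      using search_siblings[OF level_Suc_nonempty[OF Z], of k ?s1 d xs "mem s 0"]
        s level_Suc_listing(2)[OF Z]
      by (auto simp: write_list_def xs_def)
    \<comment> \<open>The list is written from the old pointer upwards, and the count to cell
      \<open>d + 3\<close>, just outside the frame, which ends at \<open>d + 2\<close>.\<close>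
    have "returned d (mem s 0) s s2"
      using s2(2) by (auto simp: returned_def write_list_def)
    then show "\<exists>t s1 u s2. exec C Op Z\<^sub>0 enter s t s1 \<and> leads s1 u s2 \<and>
        t + u = search_time C Op Z\<^sub>0 (Suc k) Z \<and> returned d (mem s 0) s s2 \<and>
        out s2 = out s @ map ((@) (cur s)) (orderings C Op Z\<^sub>0 (Suc k) Z)"
      using enter s2(1,3)
      by (intro exI[of _ "list_time Op Z\<^sub>0 Z + 2"] exI[of _ ?s1] exI[of _ ?u] exI[of _ s2])
         (simp add: xs_def)
  qed
qed

section \<open>Output and total time of the program\<close>

theorem enumerate_correct:
  "enumerates_in C Op enumerate Z\<^sub>0 (search_time C Op Z\<^sub>0 (card (ground C Z\<^sub>0)) Z\<^sub>0 + 2)"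
proof -
  let ?k = "card (ground C Z\<^sub>0)"
  \<comment> \<open>Initially every structure cell holds the input, hence also cell 1, and the zero
    pointer is an empty stack.\<close>
  let ?s = "(init_state Z\<^sub>0 :: ('s, 'e) state)\<lparr>mem := (\<lambda>_. 0)(1 := 1)\<rparr>"
  have start: "exec C Op Z\<^sub>0 (Store (Num 1) (Num 1)) (init_state Z\<^sub>0) 1 ?s"
    using exec.Store[of C Op Z\<^sub>0 "Num 1" "Num 1" "init_state Z\<^sub>0"] by (simp add: init_state_def)
  obtain t s1 u s2 where s1: "exec C Op Z\<^sub>0 enter ?s t s1" and s2: "leads s1 u s2"
    and tu: "t + u = search_time C Op Z\<^sub>0 ?k Z\<^sub>0"
    and ret: "returned 0 (mem ?s 0) ?s s2"
    and out: "out s2 = out ?s @ map ((@) (cur ?s)) (orderings C Op Z\<^sub>0 ?k Z\<^sub>0)"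
    using visits_level[OF level_input, unfolded visits_def, rule_format, of ?s 0]
    by (auto simp: init_state_def)
  have "exec C Op Z\<^sub>0 search s2 1 s2"
    unfolding search_def using ret by (intro exec.WhileFalse) (simp add: returned_def)
  then have "exec C Op Z\<^sub>0 search s1 (u + 1) s2"
    using s2 unfolding leads_def by blast
  with start s1 have "exec C Op Z\<^sub>0 enumerate (init_state Z\<^sub>0) (1 + (t + (u + 1))) s2"
    unfolding enumerate_def by (intro exec.Seq)
  moreover have "out s2 = orderings C Op Z\<^sub>0 ?k Z\<^sub>0"
    using out by (simp add: init_state_def map_idI)
  \<comment> \<open>The 2 extra steps are the initial \<open>Store\<close> and the final loop
    test.\<close>
  moreover have "1 + (t + (u + 1)) = search_time C Op Z\<^sub>0 ?k Z\<^sub>0 + 2"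
    using tu by simp
  ultimately show ?thesis
    using orderings_correct[OF level_input] unfolding enumerates_in_def by metis
qed

end


section \<open>Amortization\<close>

text \<open>Multiplying the coefficients by \<open>n\<close> amounts to differentiating termwise and
  multiplying by \<open>x\<close>, which preserves convergence inside the unit disc.\<close>

lemma summable_poly_geometric:
  fixes p :: "real poly"
  shows "norm x < 1 \<Longrightarrow> summable (\<lambda>n. poly p (real n) * x ^ n)"
proof (induction p arbitrary: x)
  case 0
  then show ?case by simp
next
  case (pCons a p)
  obtain K where "norm x < K" "K < 1"
    using pCons.prems dense by blast
  have "summable (\<lambda>n. diffs (\<lambda>n. poly p (real n)) n * x ^ n)"
    using pCons.IH \<open>K < 1\<close> by (intro termdiff_converges[OF \<open>norm x < K\<close>]) auto
  from summable_mult[OF this, of x]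
  have "summable (\<lambda>n. real (Suc n) * poly p (real (Suc n)) * x ^ Suc n)"
    by (simp add: diffs_def algebra_simps)
  then have "summable (\<lambda>n. real n * poly p (real n) * x ^ n)"
    by (subst (asm) summable_Suc_iff)
  moreover have "summable (\<lambda>n. a * x ^ n)"
    using pCons.prems by (intro summable_mult summable_geometric)
  ultimately show ?case
    using summable_add by (fastforce simp: algebra_simps)
qed

text \<open>Convergence at 3/4 gives absolute convergence at the smaller point 1/2.\<close>

lemma summable_abs_poly_half:
  fixes p :: "real poly"
  shows "summable (\<lambda>n. \<bar>poly p (real n)\<bar> * (1 / 2) ^ n)"
  using powser_insidea[OF summable_poly_geometric[of "3 / 4" p], of "1 / 2"]
  by (simp add: abs_mult)

section \<open>Charging the running time to the solutions\<close>

context enumeration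
begin

text \<open>The weight \<open>w j\<close> pays for one operation at size \<open>j\<close> with its
  overhead: 8 is 6 for the frame and 2 for the program, 15 is 6 for the descent and 9 = 7 + 2 for a
  possible leaf below. Only at \<open>k = 0\<close> does the 9 remain.\<close>

lemma search_time_le:
  fixes w :: "nat \<Rightarrow> real" and c :: nat
  assumes branching: "\<And>Z. Z \<in> structs C \<Longrightarrow> c < card (ground C Z) \<Longrightarrow> 2 \<le> card (removable C Z)"
    and list_time: "\<And>Z. (Z\<^sub>0, Z) \<in> list_calls C \<Longrightarrow>
      real (list_time Op Z\<^sub>0 Z) + 8 \<le> w (card (ground C Z))"
    and del_time: "\<And>Z e. (Z\<^sub>0, Z, e) \<in> del_calls C \<Longrightarrow>
      real (del_time Op Z\<^sub>0 Z e) + 15 \<le> w (card (ground C Z))"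
  shows "Z \<in> level k \<Longrightarrow> real (search_time C Op Z\<^sub>0 k Z) + 2 \<le> (if k = 0 then 9 else 0) +
    (2 ^ (c + 2) * (\<Sum>j=1..k. w j * (1 / 2) ^ j)) * real (length (orderings C Op Z\<^sub>0 k Z))"
proof (induction k arbitrary: Z)
  case 0
  then show ?case by simp
next
  case (Suc k)
  note Z = Suc.prems
  let ?R = "removable C Z"
  let ?N = "\<lambda>e. real (length (orderings C Op Z\<^sub>0 k (del C Z e)))"
  define a where "a = 2 ^ (c + 2) * (\<Sum>j=1..k. w j * (1 / 2) ^ j)"
  define W where "W = w (Suc k)"
  have card: "card (ground C Z) = Suc k"
    using Z by (simp add: level_def)
  have list: "real (list_time Op Z\<^sub>0 Z) + 8 \<le> W"
    using list_time[OF level_Suc_list_calls[OF Z]] card by (simp add: W_def)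
  have fin: "finite ?R"
    using level_Suc_listing(2)[OF Z] by (metis finite_set)
  then have "1 \<le> card ?R"
    using level_Suc_removable[OF Z] by (simp add: Suc_leI card_gt_0_iff)
  then have m: "1 \<le> real (card ?R)"
    by simp
  have child: "6 + real (del_time Op Z\<^sub>0 Z e) + real (search_time C Op Z\<^sub>0 k (del C Z e))
      \<le> W + a * ?N e" if e: "e \<in> ?R" for e
  proof -
    have "(Z\<^sub>0, Z, e) \<in> del_calls C"
      using e level_Suc_list_calls[OF Z] by (simp add: del_calls_def)
    then have "real (del_time Op Z\<^sub>0 Z e) + 15 \<le> W"
      using del_time[of Z e] card by (simp add: W_def)
    moreover have "real (search_time C Op Z\<^sub>0 k (del C Z e)) + 2 \<le> (if k = 0 then 9 else 0) + a * ?N e"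
      using Suc.IH[OF level_Suc_del[OF Z e]] by (simp add: a_def)
    ultimately show ?thesis
      by (auto split: if_splits)
  qed
  have "real (search_time C Op Z\<^sub>0 (Suc k) Z) + 2 =
      real (list_time Op Z\<^sub>0 Z) + 8 + (\<Sum>e\<in>?R. 6 + real (del_time Op Z\<^sub>0 Z e)
        + real (search_time C Op Z\<^sub>0 k (del C Z e)))"
    using level_Suc_listing[OF Z]
    by (simp add: sum_list_distinct_conv_sum_set)
  also have "\<dots> \<le> W + (\<Sum>e\<in>?R. W + a * ?N e)"
    by (intro add_mono[OF list] sum_mono child)
  also have "\<dots> = W * (1 + real (card ?R)) + a * (\<Sum>e\<in>?R. ?N e)"
    by (simp add: sum.distrib sum_distrib_left algebra_simps)
  \<comment> \<open>There is at least one child, so the listing at most doubles the charge.\<close>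
  also have "W * (1 + real (card ?R)) \<le> W * (2 * real (card ?R))"
    using list m by (intro mult_left_mono) auto
  \<comment> \<open>In \<open>2 ^ (c + 2)\<close>, \<open>2 ^ c\<close> makes up for the sizes
    without guaranteed branching, one factor 2 is the doubling above, the other offsets
    \<open>Suc k\<close> in the exponent.\<close>
  also have "\<dots> \<le> W * (2 ^ (c + 2) * (1 / 2) ^ Suc k * (\<Sum>e\<in>?R. ?N e))"
  proof (intro mult_left_mono)
    have "(2::real) ^ k \<le> 2 ^ c * 2 ^ (k - c)"
      by (simp flip: power_add)
    then have *: "1 \<le> 2 ^ c * (1 / 2) ^ k * (2::real) ^ (k - c)"
      by (simp add: field_simps)
    have "2 * real (card ?R) \<le> 2 ^ (c + 2) * (1 / 2) ^ Suc k * (real (card ?R) * 2 ^ (k - c))"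
      using mult_left_mono[OF *, of "2 * real (card ?R)"] by (simp add: mult_ac)
    also have "real (card ?R) * 2 ^ (k - c) \<le> (\<Sum>e\<in>?R. ?N e)"
    proof (rule sum_bounded_below)
      fix e assume "e \<in> ?R"
      then have "2 ^ (k - c) \<le> length (orderings C Op Z\<^sub>0 k (del C Z e))"
        using length_orderings_ge[OF branching] level_Suc_del[OF Z] by blast
      then show "2 ^ (k - c) \<le> ?N e"
        by (metis of_nat_le_iff of_nat_numeral of_nat_power)
    qed
    finally show "2 * real (card ?R) \<le> 2 ^ (c + 2) * (1 / 2) ^ Suc k * (\<Sum>e\<in>?R. ?N e)"
      by simp
  qed (use list in simp)
  finally have "real (search_time C Op Z\<^sub>0 (Suc k) Z) + 2 \<le>
      W * (2 ^ (c + 2) * (1 / 2) ^ Suc k * (\<Sum>e\<in>?R. ?N e)) + a * (\<Sum>e\<in>?R. ?N e)"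
    by simp
  also have "\<dots> = (2 ^ (c + 2) * (\<Sum>j=1..Suc k. w j * (1 / 2) ^ j)) * (\<Sum>e\<in>?R. ?N e)"
    by (simp add: a_def W_def algebra_simps)
  finally show ?case
    using length_orderings_Suc[OF Z] by simp
qed

end

section \<open>The amortized bound, uniform over all inputs\<close>

theorem theorem2:
  fixes C :: "('s, 'e) struct_class"
    and Op :: "('s, 'e) operations"
    and p :: "real poly"
    and q :: "nat \<Rightarrow> real"
    and inv :: "'s \<Rightarrow> nat"
    and c :: nat
  assumes "elimination_class C"
    and "implements Op C"
    and "\<And>n. 0 < q n"
    and "(\<lambda>(Z\<^sub>0, Z). real (list_time Op Z\<^sub>0 Z))
           \<in> \<Theta>[principal (list_calls C)](\<lambda>(Z\<^sub>0, Z). poly p (real (card (ground C Z))) * q (inv Z\<^sub>0))"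
    and "(\<lambda>(Z\<^sub>0, Z, e). real (del_time Op Z\<^sub>0 Z e))
           \<in> \<Theta>[principal (del_calls C)](\<lambda>(Z\<^sub>0, Z, e). poly p (real (card (ground C Z))) * q (inv Z\<^sub>0))"
    and "\<And>Z. Z \<in> structs C \<Longrightarrow> c < card (ground C Z) \<Longrightarrow> 2 \<le> card (removable C Z)"
  shows "\<exists>P T. (\<forall>Z\<in>structs C. enumerates_in C Op P Z (T Z)) \<and>
           (\<lambda>Z. real (T Z) / real (card {zs. elim_ordering C Z zs}))
             \<in> O[principal (structs C)](\<lambda>Z. q (inv Z))"
proof -
  \<comment> \<open>Over a principal filter, eventually means everywhere, so one constant serves all
    calls on all inputs.\<close>
  obtain A where A: "0 < A" "\<And>Z\<^sub>0 Z. (Z\<^sub>0, Z) \<in> list_calls C \<Longrightarrow>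
      real (list_time Op Z\<^sub>0 Z) \<le> A * (\<bar>poly p (real (card (ground C Z)))\<bar> * q (inv Z\<^sub>0))"
    using bigthetaD1[OF assms(4)]
  proof (elim landau_o.bigE)
    fix A assume "0 < A" and *: "\<forall>\<^sub>F x in principal (list_calls C).
        norm (case x of (Z\<^sub>0, Z) \<Rightarrow> real (list_time Op Z\<^sub>0 Z)) \<le>
        A * norm (case x of (Z\<^sub>0, Z) \<Rightarrow> poly p (real (card (ground C Z))) * q (inv Z\<^sub>0))"
    show thesis
      using bspec[OF *[unfolded eventually_principal]]
      by (intro that[OF \<open>0 < A\<close>]) (fastforce simp: abs_mult abs_of_pos[OF assms(3)])
  qed
  obtain B where B: "0 < B" "\<And>Z\<^sub>0 Z e. (Z\<^sub>0, Z, e) \<in> del_calls C \<Longrightarrow>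
      real (del_time Op Z\<^sub>0 Z e) \<le> B * (\<bar>poly p (real (card (ground C Z)))\<bar> * q (inv Z\<^sub>0))"
    using bigthetaD1[OF assms(5)]
  proof (elim landau_o.bigE)
    fix B assume "0 < B" and *: "\<forall>\<^sub>F x in principal (del_calls C).
        norm (case x of (Z\<^sub>0, Z, e) \<Rightarrow> real (del_time Op Z\<^sub>0 Z e)) \<le>
        B * norm (case x of (Z\<^sub>0, Z, e) \<Rightarrow> poly p (real (card (ground C Z))) * q (inv Z\<^sub>0))"
    show thesis
      using bspec[OF *[unfolded eventually_principal]]
      by (intro that[OF \<open>0 < B\<close>]) (fastforce simp: abs_mult abs_of_pos[OF assms(3)])
  qed
  \<comment> \<open>For times \<open>t\<close> of at least 1, both \<open>t + 8\<close> and
    \<open>t + 15\<close> are at most \<open>16 * t\<close>.\<close>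
  define D where "D = 16 * max A B"
  define S where "S = (\<Sum>j. \<bar>poly p (real j)\<bar> * (1 / 2) ^ j)"
  define T where "T Z = search_time C Op Z (card (ground C Z)) Z + 2" for Z
  \<comment> \<open>The first summand pays for the empty input, which has no deletion to charge; it
    is a constant because the empty structure is unique.\<close>
  define K where "K = 9 / q (inv (empty_struct C)) + 2 ^ (c + 2) * D * S"
  have D: "16 * A \<le> D" "16 * B \<le> D" "0 < D"
    using A(1) B(1) by (auto simp: D_def)
  have S: "0 \<le> S"
    unfolding S_def by (intro suminf_nonneg summable_abs_poly_half) simp
  have K: "0 < K"
    unfolding K_def using S D(3) assms(3) by (intro add_pos_nonneg) simp_all
  have "enumerates_in C Op enumerate Z (T Z)" and
    "real (T Z) / real (card {zs. elim_ordering C Z zs}) \<le> K * q (inv Z)"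
    if Z: "Z \<in> structs C" for Z
  proof -
    interpret enumeration C Op Z
      using assms(1,2) Z by unfold_locales
    show "enumerates_in C Op enumerate Z (T Z)"
      unfolding T_def by (rule enumerate_correct)
    define k where "k = card (ground C Z)"
    define N where "N = real (length (orderings C Op Z k Z))"
    define w where "w j = D * (\<bar>poly p (real j)\<bar> * q (inv Z))" for j :: nat
    have Zk: "Z \<in> level k"
      using level_input by (simp add: k_def)
    have "{zs. elim_ordering C Z zs} = set (orderings C Op Z k Z)"
      using orderings_correct[OF Zk] by simp
    then have N: "real (card {zs. elim_ordering C Z zs}) = N"
      using orderings_correct[OF Zk] by (metis N_def distinct_card)
    have "2 ^ (k - c) \<le> length (orderings C Op Z k Z)"
      using length_orderings_ge[OF assms(6) Zk] by simp
    then have "1 \<le> length (orderings C Op Z k Z)"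
      by (metis le_trans one_le_numeral one_le_power)
    then have N1: "1 \<le> N"
      by (simp add: N_def)
    have pos: "0 \<le> \<bar>poly p (real j)\<bar> * q (inv Z)" for j :: nat
      using assms(3) by (simp add: less_imp_le)
    have "real (list_time Op Z Y) + 8 \<le> w (card (ground C Y))" if "(Z, Y) \<in> list_calls C" for Y
    proof -
      have "1 \<le> list_time Op Z Y"
        using assms(2) that by (auto simp: implements_def)
      then have "real (list_time Op Z Y) + 8 \<le> 16 * real (list_time Op Z Y)"
        by simp
      also have "\<dots> \<le> w (card (ground C Y))"
        using A(2)[OF that] mult_right_mono[OF D(1) pos[of "card (ground C Y)"]]
        by (simp add: w_def)
      finally show ?thesis .
    qed
    moreover have "real (del_time Op Z Y e) + 15 \<le> w (card (ground C Y))"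
      if "(Z, Y, e) \<in> del_calls C" for Y e
    proof -
      have "1 \<le> del_time Op Z Y e"
        using assms(2) that unfolding implements_def by blast
      then have "real (del_time Op Z Y e) + 15 \<le> 16 * real (del_time Op Z Y e)"
        by simp
      also have "\<dots> \<le> w (card (ground C Y))"
        using B(2)[OF that] mult_right_mono[OF D(2) pos[of "card (ground C Y)"]]
        by (simp add: w_def)
      finally show ?thesis .
    qed
    ultimately have "real (T Z) \<le>
        (if k = 0 then 9 else 0) + (2 ^ (c + 2) * (\<Sum>j=1..k. w j * (1 / 2) ^ j)) * N"
      using search_time_le[where c = c and w = w, OF assms(6) _ _ Zk] by (simp add: T_def N_def k_def)
    also have "\<dots> \<le> 9 / q (inv (empty_struct C)) * q (inv Z) * N +
        (2 ^ (c + 2) * (D * S * q (inv Z))) * N"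
    proof (intro add_mono mult_right_mono mult_left_mono)
      show "(if k = 0 then 9 else 0) \<le> 9 / q (inv (empty_struct C)) * q (inv Z) * N"
      proof (cases "k = 0")
        case True
        then have "Z = empty_struct C"
          using Zk level_0 by simp
        then show ?thesis
          using True N1 assms(3)[of "inv Z"] by simp
      next
        case False
        then show ?thesis
          using N1 assms(3) by (simp add: less_imp_le)
      qed
      have "(\<Sum>j=1..k. \<bar>poly p (real j)\<bar> * (1 / 2) ^ j) \<le> S"
        unfolding S_def by (intro sum_le_suminf summable_abs_poly_half) auto
      then have "D * q (inv Z) * (\<Sum>j=1..k. \<bar>poly p (real j)\<bar> * (1 / 2) ^ j) \<le> D * q (inv Z) * S"
        using D(3) assms(3) by (intro mult_left_mono) (simp_all add: less_imp_le)
      then show "(\<Sum>j=1..k. w j * (1 / 2) ^ j) \<le> D * S * q (inv Z)"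
        by (simp add: w_def sum_distrib_left mult_ac)
    qed (use N1 in simp_all)
    also have "\<dots> = K * q (inv Z) * N"
      by (simp add: K_def algebra_simps)
    finally show "real (T Z) / real (card {zs. elim_ordering C Z zs}) \<le> K * q (inv Z)"
      using N N1 by (simp add: divide_le_eq)
  qed
  moreover from this(2) have "(\<lambda>Z. real (T Z) / real (card {zs. elim_ordering C Z zs}))
      \<in> O[principal (structs C)](\<lambda>Z. q (inv Z))"
    using assms(3) by (intro landau_o.bigI[OF K]) (auto simp: eventually_principal abs_of_pos)
  ultimately show ?thesis
    by blast
qed

end
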